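(* Let $f:\mathbb{C}\to\mathbb{C}$ be a non-constant entire function. Then: (1) For every $z\in\mathbb{C}$, the $\mathrm{Aut}(f)$-orbit of $z$, i.e. the set $\{\phi(z)\mid \phi\in\mathrm{Aut}(f)\}$ (where only those $\phi\in\mathrm{Aut}(f)$ are taken for which $\phi(z)$ is defined), has no finite accumulation point, i.e. no accumulation point in $\mathbb{C}$. (2) If $\phi\in\mathrm{Aut}(f)$ has a fixed point $z_0\in\mathbb{C}$, then either $\phi'(z_0)=1$ or $f'(z_0)=0$. (3) $\mathrm{Aut}(f)\cap\mathrm{Aut}(f')\subset\{z+b\mid b\in\mathbb{C}\}$, i.e. every $\phi$ which is an automorphic function of both $f$ and $f'$ has the form $\phi(z)=z+b$ for some constant $b\in\mathbb{C}$.
   Context: For an entire function $g$, an automorphic function of $g$ is a (in general many-valued) analytic function $\phi(z)$ solving the automorphic equation $g(\phi(z))=g(z)$; here a many-valued analytic function is understood as the totality of analytic continuations of a holomorphic function element, and the equation holds for all of its branches. $\mathrm{Aut}(g)$ denotes the set of all automorphic functions of $g$ (the binary operation on it is composition). A fixed point of $\phi$ is a point $z_0\in\mathbb{C}$ such that (a branch of) $\phi$ is holomorphic near $z_0$ with $\phi(z_0)=z_0$; $\phi'(z_0)$ is the derivative of that branch at $z_0$. *)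

theory Defs
  imports "HOL-Complex_Analysis.Complex_Analysis"
begin

text \<open>A holomorphic function element \<open>(a, F)\<close> is a centre \<open>a\<close> together with a power series
  \<open>F\<close> of positive radius of convergence, standing for \<open>z \<mapsto> F (z - a)\<close>.
  A many-valued analytic function is represented by the set of all its elements.\<close>

type_synonym element = "complex \<times> complex fps"

type_synonym multifunction = "element set"

definition holomorphic_element :: "element \<Rightarrow> bool" where
  "holomorphic_element e \<longleftrightarrow> fps_conv_radius (snd e) > 0"

definition element_disc :: "element \<Rightarrow> complex set" where
  "element_disc e = eball (fst e) (fps_conv_radius (snd e))"

definition element_fun :: "element \<Rightarrow> complex \<Rightarrow> complex" where
  "element_fun e z = eval_fps (snd e) (z - fst e)"

text \<open>All analytic continuations of an element, in the sense of Weierstrass: the elements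
  reached by finitely many re-expansions at a point of the current disc of convergence.\<close>

inductive_set continuations :: "element \<Rightarrow> element set" for e :: element where
  base: "e \<in> continuations e"
| step: "\<lbrakk>e' \<in> continuations e; b \<in> element_disc e';
          (\<lambda>w. element_fun e' (b + w)) has_fps_expansion G\<rbrakk> \<Longrightarrow> (b, G) \<in> continuations e"

definition many_valued_analytic :: "multifunction \<Rightarrow> bool" where
  "many_valued_analytic \<phi> \<longleftrightarrow> (\<exists>e. holomorphic_element e \<and> \<phi> = continuations e)"

text \<open>The values at \<open>z\<close> of the branches of \<open>\<phi>\<close> holomorphic near \<open>z\<close>; it is empty
  if \<open>\<phi>\<close> is not defined at \<open>z\<close>.\<close>

definition values_at :: "multifunction \<Rightarrow> complex \<Rightarrow> complex set" where
  "values_at \<phi> z = {element_fun e z | e. e \<in> \<phi> \<and> fst e = z}"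

definition Aut :: "(complex \<Rightarrow> complex) \<Rightarrow> multifunction set" where
  "Aut g = {\<phi>. many_valued_analytic \<phi> \<and>
                (\<forall>e\<in>\<phi>. \<forall>z\<in>element_disc e. g (element_fun e z) = g z)}"

definition Aut_orbit :: "(complex \<Rightarrow> complex) \<Rightarrow> complex \<Rightarrow> complex set" where
  "Aut_orbit g z = (\<Union>\<phi>\<in>Aut g. values_at \<phi> z)"

text \<open>An entire function \<open>h\<close> as a many-valued function: its Taylor expansions at all points.\<close>

definition entire_multifunction :: "(complex \<Rightarrow> complex) \<Rightarrow> multifunction" where
  "entire_multifunction h = {(a, F). (\<lambda>w. h (a + w)) has_fps_expansion F}"

end

theory Submission imports Defs begin

text \<open>A branch of \<open>\<phi> \<in> Aut f\<close> at \<open>z\<close> takes a value in the fibre of \<open>f\<close> through \<open>z\<close>, and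
  the fibres of a non-constant entire function do not accumulate, by the identity theorem
  (\<open>fibre_no_limit_point\<close>). Differentiating \<open>f \<circ> \<phi> = f\<close> gives
  \<open>(f' \<circ> \<phi>) \<cdot> \<phi>' = f'\<close> (\<open>Aut_chain_rule\<close>). At a fixed point this is the dichotomy between
  \<open>\<phi>' = 1\<close> and \<open>f' = 0\<close>. If moreover \<open>f' \<circ> \<phi> = f'\<close>, it becomes \<open>f' \<cdot> \<phi>' = f'\<close>, so \<open>\<phi>' = 1\<close>
  wherever \<open>f'\<close> does not vanish. Since \<open>f'\<close> is not identically zero on any disc, the initial
  element of \<open>\<phi>\<close> is a translation on a non-empty open set, hence it is the Taylor expansion
  of a translation, and a translation continues analytically only to itself
  (\<open>continuations_translation\<close>).\<close>

lemma continuations_holomorphic: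
  assumes "e' \<in> continuations e" "holomorphic_element e"
  shows "holomorphic_element e'"
  using assms
  by induction (auto simp: holomorphic_element_def has_fps_expansion_def)

lemma Aut_holomorphic_element:
  assumes "\<phi> \<in> Aut g" "e \<in> \<phi>"
  shows "holomorphic_element e"
  using assms continuations_holomorphic unfolding Aut_def many_valued_analytic_def by blast

lemma Aut_equation:
  assumes "\<phi> \<in> Aut g" "e \<in> \<phi>" "z \<in> element_disc e"
  shows "g (element_fun e z) = g z"
  using assms by (auto simp: Aut_def)

lemma centre_in_element_disc:
  assumes "holomorphic_element e"
  shows "fst e \<in> element_disc e"
  using assms by (simp add: holomorphic_element_def element_disc_def in_eball_iff zero_ereal_def)

lemma open_element_disc: "open (element_disc e)"
  by (simp add: element_disc_def)

lemma element_fun_holomorphic: "element_fun e holomorphic_on element_disc e"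
proof -
  have "eval_fps (snd e) \<circ> (\<lambda>z. z - fst e) holomorphic_on element_disc e"
  proof (rule holomorphic_on_compose_gen)
    show "eval_fps (snd e) holomorphic_on eball 0 (fps_conv_radius (snd e))"
      by (rule holomorphic_on_eval_fps) simp
  qed (auto simp: element_disc_def in_eball_iff dist_norm norm_minus_commute
      intro: holomorphic_intros)
  then show ?thesis
    by (simp add: element_fun_def[abs_def] o_def)
qed

lemma element_has_expansion:
  assumes "holomorphic_element e"
  shows "(\<lambda>w. element_fun e (fst e + w)) has_fps_expansion snd e"
  using assms by (simp add: holomorphic_element_def element_fun_def has_fps_expansion_def)

lemma fibre_no_limit_point:
  fixes f :: "complex \<Rightarrow> complex"
  assumes "f holomorphic_on UNIV" "\<not> f constant_on UNIV"
  shows "\<not> w islimpt {z. f z = c}"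
proof
  assume "w islimpt {z. f z = c}"
  moreover have "(\<lambda>z. f z - c) holomorphic_on UNIV"
    using assms(1) by (intro holomorphic_intros)
  ultimately have "f z - c = 0" for z
    using analytic_continuation[of "\<lambda>z. f z - c" UNIV "{z. f z = c}" w z]
    by (simp add: connected_UNIV)
  then show False
    using assms(2) by (auto simp: constant_on_def)
qed

lemma Aut_orbit_subset_fibre: "Aut_orbit f z \<subseteq> {w. f w = f z}"
  using Aut_equation centre_in_element_disc Aut_holomorphic_element
  by (fastforce simp: Aut_orbit_def values_at_def)

lemma Aut_chain_rule:
  assumes hol: "f holomorphic_on UNIV" and "\<phi> \<in> Aut f" "e \<in> \<phi>" and z: "z \<in> element_disc e"
  shows "deriv f (element_fun e z) * deriv (element_fun e) z = deriv f z"
proof -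
  have d: "(f has_field_derivative deriv f x) (at x)" for x
    using hol by (auto intro: holomorphic_derivI)
  have "(element_fun e has_field_derivative deriv (element_fun e) z) (at z)"
    using element_fun_holomorphic open_element_disc z by (rule holomorphic_derivI)
  then have "((\<lambda>x. f (element_fun e x)) has_field_derivative
      deriv f (element_fun e z) * deriv (element_fun e) z) (at z)"
    by (rule DERIV_chain2[OF d])
  then have "(f has_field_derivative
      deriv f (element_fun e z) * deriv (element_fun e) z) (at z)"
    using open_element_disc z
    by (rule has_field_derivative_transform_within_open) (rule Aut_equation[OF assms(2,3)])
  then show ?thesis
    using d DERIV_unique by blast
qed

lemma nonconstant_deriv_nonzero:
  fixes f :: "complex \<Rightarrow> complex"
  assumes hol: "f holomorphic_on UNIV" and nc: "\<not> f constant_on UNIV"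
    and U: "open U" "U \<noteq> {}"
  obtains z where "z \<in> U" "deriv f z \<noteq> 0"
proof (rule ccontr)
  assume "\<not> thesis"
  then have zero: "deriv f z = 0" if "z \<in> U" for z
    using that \<open>\<And>z. z \<in> U \<Longrightarrow> deriv f z \<noteq> 0 \<Longrightarrow> thesis\<close> by blast
  obtain a where a: "a \<in> U"
    using U by blast
  have "a islimpt U"
    using a U(1) by (intro interior_limit_point) (simp add: interior_open)
  moreover have "deriv f holomorphic_on UNIV"
    using hol by (intro holomorphic_deriv) auto
  ultimately have "deriv f z = 0" for z
    using analytic_continuation[of "deriv f" UNIV U a z] zero a by (simp add: connected_UNIV)
  then have "(f has_field_derivative 0) (at z)" for z
    using hol by (metis UNIV_I holomorphic_derivI open_UNIV)
  then have "f constant_on UNIV"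
    unfolding constant_on_def by (intro has_field_derivative_zero_constant) auto
  with nc show False ..
qed

text \<open>The derivative of the element is 1 only off the zeros of \<open>f'\<close> to begin with. It is
  enough to have this near one point: the translation found there agrees with the element on
  the whole disc by the identity theorem.\<close>

lemma Aut_deriv_translation:
  assumes hol: "f holomorphic_on UNIV" and nc: "\<not> f constant_on UNIV"
    and \<phi>: "\<phi> \<in> Aut f" "\<phi> \<in> Aut (deriv f)" and e: "e \<in> \<phi>"
  obtains b where "\<And>z. z \<in> element_disc e \<Longrightarrow> element_fun e z = z + b"
proof -
  let ?D = "element_disc e"
  have "?D \<noteq> {}"
    using centre_in_element_disc Aut_holomorphic_element[OF \<phi>(1) e] by blast
  then obtain p where p: "p \<in> ?D" "deriv f p \<noteq> 0"
    using nonconstant_deriv_nonzero[OF hol nc open_element_disc] by blast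
  have "open ({z. deriv f z \<noteq> 0} \<inter> ?D)"
    using hol open_element_disc
    by (intro open_Int open_Collect_neq holomorphic_on_imp_continuous_on holomorphic_deriv) auto
  then obtain r where r: "r > 0" "ball p r \<subseteq> {z. deriv f z \<noteq> 0} \<inter> ?D"
    using p openE[of "{z. deriv f z \<noteq> 0} \<inter> ?D" p] by blast
  have deriv_one: "(element_fun e has_field_derivative 1) (at z)" if "z \<in> ball p r" for z
  proof -
    have z: "z \<in> ?D" "deriv f z \<noteq> 0"
      using that r by auto
    have "deriv f z * deriv (element_fun e) z = deriv f z"
      using Aut_chain_rule[OF hol \<phi>(1) e z(1)] Aut_equation[OF \<phi>(2) e z(1)] by simp
    then have "deriv (element_fun e) z = 1"
      using z by simp
    then show ?thesis
      using holomorphic_derivI[OF element_fun_holomorphic open_element_disc z(1)] by simp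
  qed
  have "\<exists>b. \<forall>z\<in>ball p r. element_fun e z - z = b"
  proof (rule has_field_derivative_zero_constant)
    fix z assume "z \<in> ball p r"
    then have "((\<lambda>z. element_fun e z - z) has_field_derivative 1 - 1) (at z)"
      by (intro DERIV_diff deriv_one DERIV_ident)
    then show "((\<lambda>z. element_fun e z - z) has_field_derivative 0) (at z within ball p r)"
      by (simp add: has_field_derivative_at_within)
  qed simp
  then obtain b where b: "\<And>z. z \<in> ball p r \<Longrightarrow> element_fun e z - z = b"
    by blast
  have conn: "connected ?D"
    unfolding element_disc_def by (rule connected_eball)
  have "(\<lambda>z. element_fun e z - z - b) holomorphic_on ?D"
    by (intro holomorphic_intros element_fun_holomorphic)
  moreover have "p islimpt ball p r"
    using r by (simp add: islimpt_ball)
  moreover have "ball p r \<subseteq> ?D"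
    using r by blast
  ultimately have "element_fun e z - z - b = 0" if "z \<in> ?D" for z
    using analytic_continuation[of "\<lambda>z. element_fun e z - z - b" ?D "ball p r" p z]
      open_element_disc conn p(1) b that by simp
  then show thesis
    by (intro that[of b]) (simp add: algebra_simps)
qed

lemma entire_multifunction_translation_iff:
  "(a, F) \<in> entire_multifunction (\<lambda>z. z + b) \<longleftrightarrow> F = fps_const (a + b) + fps_X"
proof -
  have "(\<lambda>w. (a + b) + w) has_fps_expansion fps_const (a + b) + fps_X"
    by (intro fps_expansion_intros)
  then have "(\<lambda>w. a + w + b) has_fps_expansion fps_const (a + b) + fps_X"
    by (simp add: algebra_simps)
  then show ?thesis
    using fps_expansion_unique_complex by (auto simp: entire_multifunction_def)
qed

text \<open>The Taylor series of a translation is a polynomial, so its disc of convergence is the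
  whole plane: a single re-expansion reaches every other element, and none leads elsewhere.\<close>

lemma continuations_translation:
  assumes e: "e \<in> entire_multifunction (\<lambda>z. z + b)"
  shows "continuations e = entire_multifunction (\<lambda>z. z + b)"
proof
  have disc: "element_disc e' = UNIV" and fun_eq: "element_fun e' = (\<lambda>z. z + b)"
    if "e' \<in> entire_multifunction (\<lambda>z. z + b)" for e'
  proof -
    obtain a F where e': "e' = (a, F)"
      by (cases e')
    with that have F: "F = fps_const (a + b) + fps_X"
      by (simp add: entire_multifunction_translation_iff)
    have "fps_conv_radius F \<ge> \<infinity>"
      unfolding F by (rule fps_conv_radius_add_ge) simp_all
    then have "fps_conv_radius F = \<infinity>"
      by simp
    then show "element_disc e' = UNIV"
      by (simp add: e' element_disc_def)
    show "element_fun e' = (\<lambda>z. z + b)"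
      by (auto simp: e' F element_fun_def eval_fps_add)
  qed
  show "continuations e \<subseteq> entire_multifunction (\<lambda>z. z + b)"
  proof
    fix x assume "x \<in> continuations e"
    then show "x \<in> entire_multifunction (\<lambda>z. z + b)"
    proof induction
      case (step e' c G)
      then show ?case
        by (simp add: fun_eq entire_multifunction_def)
    qed (rule e)
  qed
  show "entire_multifunction (\<lambda>z. z + b) \<subseteq> continuations e"
  proof
    fix x assume x: "x \<in> entire_multifunction (\<lambda>z. z + b)"
    have "(\<lambda>w. element_fun e (fst x + w)) has_fps_expansion snd x"
      using x by (simp add: fun_eq[OF e] entire_multifunction_def case_prod_beta)
    moreover have "fst x \<in> element_disc e"
      by (simp add: disc[OF e])
    ultimately show "x \<in> continuations e"
      using continuations.step[OF continuations.base] by (metis prod.collapse)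
  qed
qed

lemma Aut_Int_Aut_deriv_subset:
  assumes hol: "f holomorphic_on UNIV" and nc: "\<not> f constant_on UNIV"
  shows "Aut f \<inter> Aut (deriv f) \<subseteq> {entire_multifunction (\<lambda>z. z + b) | b. True}"
proof
  fix \<phi> assume "\<phi> \<in> Aut f \<inter> Aut (deriv f)"
  then have \<phi>: "\<phi> \<in> Aut f" "\<phi> \<in> Aut (deriv f)"
    by auto
  then obtain e where e: "holomorphic_element e" "\<phi> = continuations e"
    by (auto simp: Aut_def many_valued_analytic_def)
  then have "e \<in> \<phi>"
    by (simp add: continuations.base)
  then obtain b where b: "\<And>z. z \<in> element_disc e \<Longrightarrow> element_fun e z = z + b"
    using Aut_deriv_translation[OF hol nc \<phi>] by blast
  have exp: "(\<lambda>w. element_fun e (fst e + w)) has_fps_expansion snd e"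
    using e(1) by (rule element_has_expansion)
  have "((\<lambda>w. fst e + w) \<longlongrightarrow> fst e + 0) (nhds 0)"
    by (intro tendsto_add tendsto_const filterlim_ident)
  then have "eventually (\<lambda>w. fst e + w \<in> element_disc e) (nhds 0)"
    using open_element_disc centre_in_element_disc[OF e(1)]
    by (metis add.right_neutral topological_tendstoD)
  then have "eventually (\<lambda>w. element_fun e (fst e + w) = fst e + w + b) (nhds 0)"
    by eventually_elim (rule b)
  then have "(\<lambda>w. fst e + w + b) has_fps_expansion snd e"
    by (rule has_fps_expansion_cong[OF _ refl, THEN iffD1]) (rule exp)
  then have "e \<in> entire_multifunction (\<lambda>z. z + b)"
    by (simp add: entire_multifunction_def case_prod_beta)
  then show "\<phi> \<in> {entire_multifunction (\<lambda>z. z + b) | b. True}"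
    using continuations_translation e(2) by blast
qed

theorem proposition2p1:
  fixes f :: "complex \<Rightarrow> complex"
  assumes "f holomorphic_on UNIV" and "\<not> f constant_on UNIV"
  shows "(\<forall>z. \<not> (\<exists>w. w islimpt Aut_orbit f z))
    \<and> (\<forall>\<phi>\<in>Aut f. \<forall>z\<^sub>0 F. (z\<^sub>0, F) \<in> \<phi> \<and> element_fun (z\<^sub>0, F) z\<^sub>0 = z\<^sub>0 \<longrightarrow>
          deriv (element_fun (z\<^sub>0, F)) z\<^sub>0 = 1 \<or> deriv f z\<^sub>0 = 0)
    \<and> Aut f \<inter> Aut (deriv f) \<subseteq> {entire_multifunction (\<lambda>z. z + b) | b. True}"
proof (intro conjI allI ballI impI)
  fix z
  show "\<not> (\<exists>w. w islimpt Aut_orbit f z)"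
    using fibre_no_limit_point[OF assms] islimpt_subset[OF _ Aut_orbit_subset_fibre] by blast
next
  fix \<phi> z\<^sub>0 F
  assume \<phi>: "\<phi> \<in> Aut f" and fix_pt: "(z\<^sub>0, F) \<in> \<phi> \<and> element_fun (z\<^sub>0, F) z\<^sub>0 = z\<^sub>0"
  have "z\<^sub>0 \<in> element_disc (z\<^sub>0, F)"
    using centre_in_element_disc Aut_holomorphic_element[OF \<phi>] fix_pt by fastforce
  then have "deriv f z\<^sub>0 * deriv (element_fun (z\<^sub>0, F)) z\<^sub>0 = deriv f z\<^sub>0"
    using Aut_chain_rule[OF assms(1) \<phi>] fix_pt by metis
  then show "deriv (element_fun (z\<^sub>0, F)) z\<^sub>0 = 1 \<or> deriv f z\<^sub>0 = 0"
    by auto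
next
  show "Aut f \<inter> Aut (deriv f) \<subseteq> {entire_multifunction (\<lambda>z. z + b) | b. True}"
    using assms by (rule Aut_Int_Aut_deriv_subset)
qed

end
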